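(* Let $G$ be a topological group with topology $\sigma$, and suppose $G$ acts on a group $H$ as automorphisms. Identify $G$ and $H$ with the subgroups $\{e\}\times G$ and $H\times\{e\}$ of $H\rtimes G$, respectively. Let $D$ be the discrete topology on $H$, let $D\times\sigma$ be the product topology on (the underlying set $H\times G$ of) $H\rtimes G$, and put $T=(D\times\sigma)^*$, a group topology on $H\rtimes G$. Denote by $T_H$ and $T_G$ the topologies induced by $T$ on the subgroups identified with $H$ and $G$, respectively. Then: (1) $T_G=\sigma$. (2) $T_H$ is a group topology on $H$ under which the action of $G$ on $H$ is continuous. (3) If $\rho$ is another group topology on $H$ under which the action of $G$ on $H$ is continuous, then $T_H$ is finer than $\rho$ (i.e. $\rho\subseteq T_H$).
   Context: A topological group is a group with a topology for which multiplication and inversion are continuous; it is not assumed to be Hausdorff. Such a topology is called a group topology. "The action of $G$ on $H$ is continuous" means that the map $G\times H\to H$, $(g,h)\mapsto gh$, is continuous (jointly). "Finer" is not meant strictly. The semidirect product $H\rtimes G$ is the set $H\times G$ with multiplication $(h,g)(h',g')=(h\cdot g(h'),gg')$. Definition of $\rho^*$. Let $K$ be a group with neutral element $e$. For $S\subseteq K$ write $S^*=S\cup\{e\}\cup S^{-1}$. For a $\mathbb{Q}$-tuple $(S_q)_{q\in\mathbb{Q}}$ of subsets of $K$ put $$U((S_q)_{q\in\mathbb{Q}})=\bigcup_{n<\omega}\ \bigcup_{q_1<\dots<q_n\in\mathbb{Q}}S_{q_1}^*\cdots S_{q_n}^*.$$ For a family $F$ of subsets of $K$, let $F^K$ be the collection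 of all subsets of $K$ of the form $\bigcup_{g\in K}gS_gg^{-1}$ for $K$-tuples $(S_g)_{g\in K}$ of members of $F$. For a downward directed family $F$ of nonempty subsets of $K$, the sets $U((S_q)_{q\in\mathbb{Q}})$, where $(S_q)_{q\in\mathbb{Q}}$ ranges over all $\mathbb{Q}$-tuples of members of $F^K$, form a basis of open neighbourhoods of $e$ in a group topology $\mathcal{T}_F$ on $K$, which is the finest group topology on $K$ under which $F$ converges to $e$ (i.e. every neighbourhood of $e$ contains a member of $F$) (a known result of Bergman). If $\rho$ is a topology on $K$ (not necessarily a group topology), $\rho^*$ denotes $\mathcal{T}_F$, where $F$ is the family of $\rho$-open neighbourhoods of $e$. *)

theory Defs
  imports "HOL-Analysis.Analysis" "HOL-Algebra.Coset" "HOL-Algebra.Bij"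
begin

(* No separation axiom is imposed. *)
definition topological_group :: "('a, 'm) monoid_scheme \<Rightarrow> 'a topology \<Rightarrow> bool" where
  "topological_group K T \<longleftrightarrow>
     group K \<and> topspace T = carrier K \<and>
     continuous_map (prod_topology T T) T (\<lambda>(x, y). x \<otimes>\<^bsub>K\<^esub> y) \<and>
     continuous_map T T (\<lambda>x. inv\<^bsub>K\<^esub> x)"

definition continuous_action ::
    "'g topology \<Rightarrow> 'h topology \<Rightarrow> ('g \<Rightarrow> 'h \<Rightarrow> 'h) \<Rightarrow> bool" where
  "continuous_action \<sigma> \<tau> \<phi> \<longleftrightarrow> continuous_map (prod_topology \<sigma> \<tau>) \<tau> (\<lambda>(g, h). \<phi> g h)"

definition finer_topology :: "'a topology \<Rightarrow> 'a topology \<Rightarrow> bool" where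
  "finer_topology T \<rho> \<longleftrightarrow> (\<forall>W. openin \<rho> W \<longrightarrow> openin T W)"

definition semidirect_product ::
    "('h, 'm) monoid_scheme \<Rightarrow> ('g, 'n) monoid_scheme \<Rightarrow> ('g \<Rightarrow> 'h \<Rightarrow> 'h) \<Rightarrow> ('h \<times> 'g) monoid" where
  "semidirect_product H G \<phi> =
     \<lparr>carrier = carrier H \<times> carrier G,
      mult = (\<lambda>(h, g) (h', g'). (h \<otimes>\<^bsub>H\<^esub> \<phi> g h', g \<otimes>\<^bsub>G\<^esub> g')),
      one = (\<one>\<^bsub>H\<^esub>, \<one>\<^bsub>G\<^esub>)\<rparr>"

definition sym_hull :: "('a, 'm) monoid_scheme \<Rightarrow> 'a set \<Rightarrow> 'a set" where
  "sym_hull K S = S \<union> {\<one>\<^bsub>K\<^esub>} \<union> (\<lambda>x. inv\<^bsub>K\<^esub> x) ` S"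

(* A strictly increasing list of rationals encodes the index tuple q_1 < ... < q_n;
   the empty list (n = 0) contributes the empty product {e}. *)
definition rat_products :: "('a, 'm) monoid_scheme \<Rightarrow> (rat \<Rightarrow> 'a set) \<Rightarrow> 'a set" where
  "rat_products K S =
     (\<Union>qs \<in> {qs. sorted_wrt (<) qs}.
        foldr (\<lambda>q A. sym_hull K (S q) <#>\<^bsub>K\<^esub> A) qs {\<one>\<^bsub>K\<^esub>})"

definition conj_family :: "('a, 'm) monoid_scheme \<Rightarrow> 'a set set \<Rightarrow> 'a set set" where
  "conj_family K F =
     {(\<Union>g\<in>carrier K. (g <#\<^bsub>K\<^esub> S g) #>\<^bsub>K\<^esub> inv\<^bsub>K\<^esub> g) | S. S \<in> carrier K \<rightarrow> F}"

(* The topology whose neighbourhood filter at x is generated by the left translates x U((S_q)),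
   with all S_q in conj_family K F.  As the sets U((S_q)) form a basis of neighbourhoods of the
   neutral element in a group topology, these are exactly the open sets of that group topology. *)
definition group_topology_of_family ::
    "('a, 'm) monoid_scheme \<Rightarrow> 'a set set \<Rightarrow> 'a topology" where
  "group_topology_of_family K F =
     topology (\<lambda>W. W \<subseteq> carrier K \<and>
       (\<forall>x\<in>W. \<exists>S. (\<forall>q. S q \<in> conj_family K F) \<and> x <#\<^bsub>K\<^esub> rat_products K S \<subseteq> W))"

definition star_topology :: "('a, 'm) monoid_scheme \<Rightarrow> 'a topology \<Rightarrow> 'a topology" where
  "star_topology K \<rho> = group_topology_of_family K {V. openin \<rho> V \<and> \<one>\<^bsub>K\<^esub> \<in> V}"

lemma rat_products_mono:
  assumes "\<And>q. S q \<subseteq> S' q"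
  shows "rat_products K S \<subseteq> rat_products K S'"
proof -
  have hull: "sym_hull K (S q) \<subseteq> sym_hull K (S' q)" for q
    using assms[of q] by (auto simp: sym_hull_def)
  have "foldr (\<lambda>q A. sym_hull K (S q) <#>\<^bsub>K\<^esub> A) qs {\<one>\<^bsub>K\<^esub>}
      \<subseteq> foldr (\<lambda>q A. sym_hull K (S' q) <#>\<^bsub>K\<^esub> A) qs {\<one>\<^bsub>K\<^esub>}" for qs
  proof (induction qs)
    case (Cons q qs)
    with hull[of q] show ?case
      unfolding foldr.simps o_apply set_mult_def by blast
  qed simp
  then show ?thesis
    unfolding rat_products_def by blast
qed

lemma conj_family_directed:
  assumes F: "\<And>A B. A \<in> F \<Longrightarrow> B \<in> F \<Longrightarrow> \<exists>C\<in>F. C \<subseteq> A \<inter> B"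
    and X: "X \<in> conj_family K F" and Y: "Y \<in> conj_family K F"
  shows "\<exists>Z\<in>conj_family K F. Z \<subseteq> X \<inter> Y"
proof -
  let ?u = "\<lambda>S. \<Union>g\<in>carrier K. (g <#\<^bsub>K\<^esub> S g) #>\<^bsub>K\<^esub> inv\<^bsub>K\<^esub> g"
  obtain S where S: "S \<in> carrier K \<rightarrow> F" "X = ?u S"
    using X unfolding conj_family_def by blast
  obtain S' where S': "S' \<in> carrier K \<rightarrow> F" "Y = ?u S'"
    using Y unfolding conj_family_def by blast
  have "\<forall>g\<in>carrier K. \<exists>C\<in>F. C \<subseteq> S g \<inter> S' g"
    using F S(1) S'(1) by (simp add: Pi_iff)
  then obtain R where R: "\<forall>g\<in>carrier K. R g \<in> F \<and> R g \<subseteq> S g \<inter> S' g"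
    by metis
  have "?u R \<in> conj_family K F"
    unfolding conj_family_def using R by blast
  moreover have "?u R \<subseteq> X \<inter> Y"
    unfolding S(2) S'(2) l_coset_def r_coset_def using R by blast
  ultimately show ?thesis by blast
qed

lemma openin_group_topology_of_family:
  assumes F: "\<And>A B. A \<in> F \<Longrightarrow> B \<in> F \<Longrightarrow> \<exists>C\<in>F. C \<subseteq> A \<inter> B"
  shows "openin (group_topology_of_family K F) W \<longleftrightarrow>
    W \<subseteq> carrier K \<and>
    (\<forall>x\<in>W. \<exists>S. (\<forall>q. S q \<in> conj_family K F) \<and> x <#\<^bsub>K\<^esub> rat_products K S \<subseteq> W)"
proof -
  let ?N = "\<lambda>W x. \<exists>S. (\<forall>q. S q \<in> conj_family K F) \<and> x <#\<^bsub>K\<^esub> rat_products K S \<subseteq> W"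
  have inter: "?N (V \<inter> W) x" if V: "?N V x" and W: "?N W x" for V W x
  proof -
    obtain S where S: "\<forall>q. S q \<in> conj_family K F" "x <#\<^bsub>K\<^esub> rat_products K S \<subseteq> V"
      using V by blast
    obtain S' where S': "\<forall>q. S' q \<in> conj_family K F" "x <#\<^bsub>K\<^esub> rat_products K S' \<subseteq> W"
      using W by blast
    have "\<forall>q. \<exists>Z\<in>conj_family K F. Z \<subseteq> S q \<inter> S' q"
      using conj_family_directed[OF F] S(1) S'(1) by blast
    then obtain R where R: "\<forall>q. R q \<in> conj_family K F \<and> R q \<subseteq> S q \<inter> S' q"
      by metis
    then have "rat_products K R \<subseteq> rat_products K S" "rat_products K R \<subseteq> rat_products K S'"
      by (auto intro!: rat_products_mono del: subsetI)
    then have "x <#\<^bsub>K\<^esub> rat_products K R \<subseteq> V \<inter> W"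
      using S(2) S'(2) unfolding l_coset_def by blast
    with R show ?thesis by blast
  qed
  have up: "?N W x" if "?N V x" "V \<subseteq> W" for V W x
    using that by (meson subset_trans)
  have "istopology (\<lambda>W. W \<subseteq> carrier K \<and> (\<forall>x\<in>W. ?N W x))"
    unfolding istopology_def
  proof (intro conjI allI impI)
    fix \<K> assume \<K>: "\<forall>W\<in>\<K>. W \<subseteq> carrier K \<and> (\<forall>x\<in>W. ?N W x)"
    then show "\<Union>\<K> \<subseteq> carrier K" by blast
    show "\<forall>x\<in>\<Union>\<K>. ?N (\<Union>\<K>) x"
    proof
      fix x assume "x \<in> \<Union>\<K>"
      then obtain V where "V \<in> \<K>" "x \<in> V" by blast
      with \<K> show "?N (\<Union>\<K>) x" using up[of x V "\<Union>\<K>"] by blast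
    qed
  next
    fix V W
    assume V: "V \<subseteq> carrier K \<and> (\<forall>x\<in>V. ?N V x)" and W: "W \<subseteq> carrier K \<and> (\<forall>x\<in>W. ?N W x)"
    show "V \<inter> W \<subseteq> carrier K" using V by blast
    show "\<forall>x\<in>V \<inter> W. ?N (V \<inter> W) x"
    proof
      fix x assume "x \<in> V \<inter> W"
      then show "?N (V \<inter> W) x" using V W by (intro inter) blast+
    qed
  qed
  then show ?thesis
    unfolding group_topology_of_family_def by (simp add: topology_inverse')
qed

lemma openin_star_topology:
  "openin (star_topology K \<rho>) W \<longleftrightarrow>
    W \<subseteq> carrier K \<and>
    (\<forall>x\<in>W. \<exists>S. (\<forall>q. S q \<in> conj_family K {V. openin \<rho> V \<and> \<one>\<^bsub>K\<^esub> \<in> V}) \<and>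
                 x <#\<^bsub>K\<^esub> rat_products K S \<subseteq> W)"
proof -
  have "\<exists>C\<in>{V. openin \<rho> V \<and> \<one>\<^bsub>K\<^esub> \<in> V}. C \<subseteq> A \<inter> B"
    if "A \<in> {V. openin \<rho> V \<and> \<one>\<^bsub>K\<^esub> \<in> V}" "B \<in> {V. openin \<rho> V \<and> \<one>\<^bsub>K\<^esub> \<in> V}" for A B
    using that by (intro bexI[of _ "A \<inter> B"]) auto
  then show ?thesis
    unfolding star_topology_def by (rule openin_group_topology_of_family)
qed

end

theory Submission
  imports Defs
begin

text \<open>
  Write \<open>K\<close> for the semidirect product and \<open>T\<close> for the topology \<open>(D \<times> \<sigma>)\<^sup>*\<close>. Two facts about the
  topology \<open>\<T>\<close> of a directed family \<open>F\<close> on an arbitrary group carry the proof: it is a group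
  topology (\<open>topological_group_family\<close>), and it refines every group topology in which \<open>F\<close> converges
  to the neutral element (\<open>finer_than_group_topology\<close>). Both are due to Bergman. The first rests on
  the order structure of the rationals: two copies of the rationals, one placed after the other, embed
  into the rationals, so every set \<open>U((S\<^sub>q))\<close> contains the square of another such set. The second chooses the sets
  \<open>S\<^sub>q\<close> along an enumeration of the rationals so that they shrink fast enough for every product with
  distinct indices to stay in a prescribed neighbourhood.

  If \<open>\<rho>\<close> is any group topology on \<open>H\<close> for which the action is continuous, the formulas for
  multiplication and inversion in \<open>K\<close> show that \<open>\<rho> \<times> \<sigma>\<close> is a group topology on \<open>K\<close>. It is coarser
  than \<open>D \<times> \<sigma>\<close>, so the neighbourhoods of the neutral element in \<open>D \<times> \<sigma>\<close> converge in it, and \<open>T\<close>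
  refines \<open>\<rho> \<times> \<sigma>\<close> (\<open>openin_T_Times\<close>). Restricting to \<open>H\<close> gives the third claim. The indiscrete
  topology is always an admissible \<open>\<rho>\<close>, and restricting to \<open>G\<close> then shows that \<open>T\<^sub>G\<close> is finer than
  \<open>\<sigma>\<close>. The converse is the continuity of the inclusion of \<open>(G, \<sigma>)\<close> in \<open>(K, T)\<close>
  (\<open>continuous_map_inclusion_G\<close>), which holds because every basic neighbourhood for \<open>T\<close> contains a
  neighbourhood for \<open>D \<times> \<sigma>\<close>.

  Finally, the action of \<open>G\<close> on \<open>H\<close> is conjugation inside \<open>K\<close>. As conjugation is continuous in \<open>T\<close>
  and \<open>G\<close> carries the topology \<open>\<sigma>\<close>, the action is continuous for \<open>T\<^sub>H\<close>.
\<close>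

section \<open>Continuity in topological groups\<close>

lemma topological_group_continuous_mult:
  assumes "topological_group K \<tau>" "continuous_map X \<tau> f" "continuous_map X \<tau> g"
  shows "continuous_map X \<tau> (\<lambda>x. f x \<otimes>\<^bsub>K\<^esub> g x)"
proof -
  have "continuous_map X \<tau> ((\<lambda>(x, y). x \<otimes>\<^bsub>K\<^esub> y) \<circ> (\<lambda>x. (f x, g x)))"
    using continuous_map_compose[OF continuous_map_pairedI[OF assms(2,3)]] assms(1)
    unfolding topological_group_def by blast
  then show ?thesis by (simp add: o_def)
qed

lemma topological_group_continuous_inv:
  assumes "topological_group K \<tau>" "continuous_map X \<tau> f"
  shows "continuous_map X \<tau> (\<lambda>x. inv\<^bsub>K\<^esub> (f x))"
  using continuous_map_compose[OF assms(2), of \<tau> "\<lambda>x. inv\<^bsub>K\<^esub> x"] assms(1)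
  by (simp add: topological_group_def o_def)

lemma topological_group_continuous_translate:
  assumes "topological_group K \<tau>" "x \<in> carrier K"
  shows "continuous_map \<tau> \<tau> (\<lambda>y. x \<otimes>\<^bsub>K\<^esub> y)"
  using assms by (intro topological_group_continuous_mult[OF assms(1)])
    (auto simp: topological_group_def)

lemma topological_group_continuous_conj:
  assumes "topological_group K \<tau>" "x \<in> carrier K"
  shows "continuous_map \<tau> \<tau> (\<lambda>y. x \<otimes>\<^bsub>K\<^esub> y \<otimes>\<^bsub>K\<^esub> inv\<^bsub>K\<^esub> x)"
  using assms
  by (intro topological_group_continuous_mult[OF assms(1)])
     (auto simp: topological_group_def group.inv_closed)

text \<open>
  Cubes rather than squares are what the shrinking argument below consumes: a product of sets with
  distinct indices is cut at its smallest index into a left part, that factor, and a right part.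
\<close>

lemma topological_group_cube_neighbourhood:
  assumes K: "topological_group K \<tau>" and W: "openin \<tau> W" "\<one>\<^bsub>K\<^esub> \<in> W"
  shows "\<exists>V. openin \<tau> V \<and> \<one>\<^bsub>K\<^esub> \<in> V \<and> (\<forall>x\<in>V. inv\<^bsub>K\<^esub> x \<in> V) \<and>
           (\<forall>x\<in>V. \<forall>y\<in>V. \<forall>z\<in>V. x \<otimes>\<^bsub>K\<^esub> (y \<otimes>\<^bsub>K\<^esub> z) \<in> W)"
proof -
  interpret group K using K by (simp add: topological_group_def)
  have top: "topspace \<tau> = carrier K" using K by (simp add: topological_group_def)
  have square: "\<exists>V. openin \<tau> V \<and> \<one>\<^bsub>K\<^esub> \<in> V \<and> (\<forall>x\<in>V. \<forall>y\<in>V. x \<otimes>\<^bsub>K\<^esub> y \<in> W)"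
    if W: "openin \<tau> W" "\<one>\<^bsub>K\<^esub> \<in> W" for W
  proof -
    have "openin (prod_topology \<tau> \<tau>)
        {p \<in> topspace (prod_topology \<tau> \<tau>). (\<lambda>(x, y). x \<otimes>\<^bsub>K\<^esub> y) p \<in> W}"
      using K W(1) unfolding topological_group_def
      by (intro openin_continuous_map_preimage) auto
    moreover have "(\<one>\<^bsub>K\<^esub>, \<one>\<^bsub>K\<^esub>) \<in> {p \<in> topspace (prod_topology \<tau> \<tau>). (\<lambda>(x, y). x \<otimes>\<^bsub>K\<^esub> y) p \<in> W}"
      using W(2) by (simp add: top)
    ultimately obtain A B where AB: "openin \<tau> A" "openin \<tau> B" "\<one>\<^bsub>K\<^esub> \<in> A" "\<one>\<^bsub>K\<^esub> \<in> B"
      "A \<times> B \<subseteq> {p \<in> topspace (prod_topology \<tau> \<tau>). (\<lambda>(x, y). x \<otimes>\<^bsub>K\<^esub> y) p \<in> W}"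
      unfolding openin_prod_topology_alt by meson
    then show ?thesis
      by (intro exI[of _ "A \<inter> B"]) auto
  qed
  obtain A where A: "openin \<tau> A" "\<one>\<^bsub>K\<^esub> \<in> A" "\<forall>x\<in>A. \<forall>y\<in>A. x \<otimes>\<^bsub>K\<^esub> y \<in> W"
    using square[OF W] by blast
  obtain B where B: "openin \<tau> B" "\<one>\<^bsub>K\<^esub> \<in> B" "\<forall>x\<in>B. \<forall>y\<in>B. x \<otimes>\<^bsub>K\<^esub> y \<in> A"
    using square[OF A(1,2)] by blast
  have sub: "A \<subseteq> carrier K" "B \<subseteq> carrier K"
    using A(1) B(1) openin_subset top by auto
  have BA: "B \<subseteq> A" using B(2,3) sub by force
  define V where "V = B \<inter> {x \<in> topspace \<tau>. inv\<^bsub>K\<^esub> x \<in> B}"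
  have "openin \<tau> V" unfolding V_def
    using K B(1) unfolding topological_group_def
    by (intro openin_Int openin_continuous_map_preimage) auto
  moreover have "\<one>\<^bsub>K\<^esub> \<in> V" using B(2) by (simp add: V_def top)
  moreover have "\<forall>x\<in>V. inv\<^bsub>K\<^esub> x \<in> V" using sub by (auto simp: V_def top)
  moreover have "\<forall>x\<in>V. \<forall>y\<in>V. \<forall>z\<in>V. x \<otimes>\<^bsub>K\<^esub> (y \<otimes>\<^bsub>K\<^esub> z) \<in> W"
    using A(3) B(3) BA by (auto simp: V_def)
  ultimately show ?thesis by blast
qed

section \<open>Products along increasing sequences of rationals\<close>

definition indexed_product :: "('a, 'm) monoid_scheme \<Rightarrow> ('i \<Rightarrow> 'a set) \<Rightarrow> 'i list \<Rightarrow> 'a set" where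
  "indexed_product K S qs = foldr (\<lambda>q A. sym_hull K (S q) <#>\<^bsub>K\<^esub> A) qs {\<one>\<^bsub>K\<^esub>}"

lemma indexed_product_Nil [simp]: "indexed_product K S [] = {\<one>\<^bsub>K\<^esub>}"
  and indexed_product_Cons [simp]:
    "indexed_product K S (q # qs) = sym_hull K (S q) <#>\<^bsub>K\<^esub> indexed_product K S qs"
  by (simp_all add: indexed_product_def)

lemma indexed_product_map:
  "indexed_product K S (map f qs) = indexed_product K (\<lambda>q. S (f q)) qs"
  by (simp add: indexed_product_def foldr_map o_def)

lemma mem_rat_products_iff:
  "x \<in> rat_products K S \<longleftrightarrow> (\<exists>qs. sorted_wrt (<) qs \<and> x \<in> indexed_product K S qs)"
  by (auto simp: rat_products_def indexed_product_def)

text \<open>The members of \<open>F\<^sup>K\<close>, written elementwise instead of with left and right cosets.\<close>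

definition conj_union :: "('a, 'm) monoid_scheme \<Rightarrow> ('a \<Rightarrow> 'a set) \<Rightarrow> 'a set" where
  "conj_union K A = {g \<otimes>\<^bsub>K\<^esub> s \<otimes>\<^bsub>K\<^esub> inv\<^bsub>K\<^esub> g | g s. g \<in> carrier K \<and> s \<in> A g}"

lemma mem_conj_family_iff:
  "X \<in> conj_family K F \<longleftrightarrow> (\<exists>A. A \<in> carrier K \<rightarrow> F \<and> X = conj_union K A)"
proof -
  have "(\<Union>g\<in>carrier K. (g <#\<^bsub>K\<^esub> A g) #>\<^bsub>K\<^esub> inv\<^bsub>K\<^esub> g) = conj_union K A" for A
    unfolding conj_union_def l_coset_def r_coset_def by blast
  then show ?thesis
    unfolding conj_family_def by auto
qed

context group
begin

lemma sym_hull_subset_carrier: "A \<subseteq> carrier G \<Longrightarrow> sym_hull G A \<subseteq> carrier G"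
  by (auto simp: sym_hull_def)

lemma indexed_product_subset_carrier:
  assumes "\<And>q. S q \<subseteq> carrier G"
  shows "indexed_product G S qs \<subseteq> carrier G"
  by (induction qs) (auto simp: set_mult_closed sym_hull_subset_carrier assms)

lemma indexed_product_append:
  assumes "\<And>q. S q \<subseteq> carrier G"
  shows "indexed_product G S (ps @ qs) = indexed_product G S ps <#> indexed_product G S qs"
proof (induction ps)
  case Nil
  show ?case
    using indexed_product_subset_carrier[of S qs, OF assms] by (force simp: set_mult_def)
next
  case (Cons p ps)
  then show ?case
    by (simp add: set_mult_assoc sym_hull_subset_carrier indexed_product_subset_carrier assms)
qed

lemma mult_mem_indexed_product_append:
  assumes "\<And>q. S q \<subseteq> carrier G" "x \<in> indexed_product G S ps" "y \<in> indexed_product G S qs"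
  shows "x \<otimes> y \<in> indexed_product G S (ps @ qs)"
  using assms(2,3) unfolding indexed_product_append[of S, OF assms(1)] set_mult_def by blast

lemma mem_indexed_product_singleton:
  assumes "S q \<subseteq> carrier G" "s \<in> sym_hull G (S q)"
  shows "s \<in> indexed_product G S [q]"
proof -
  have "s \<in> carrier G" using assms(2) sym_hull_subset_carrier[OF assms(1)] by blast
  then have "s = s \<otimes> \<one>" by simp
  then show ?thesis
    using assms(2) unfolding indexed_product_Cons indexed_product_Nil set_mult_def by blast
qed

text \<open>
  Each factor is closed under inversion, so inverting a product only reverses the order of its
  indices.
\<close>

lemma indexed_product_rev:
  assumes S: "\<And>q. S q \<subseteq> carrier G" and "x \<in> indexed_product G S qs"
  shows "inv x \<in> indexed_product G S (rev qs)"
  using assms(2)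
proof (induction qs arbitrary: x)
  case (Cons q qs)
  then obtain s y where sy: "s \<in> sym_hull G (S q)" "y \<in> indexed_product G S qs" "x = s \<otimes> y"
    by (auto simp: set_mult_def)
  have car: "s \<in> carrier G" "y \<in> carrier G"
    using sy sym_hull_subset_carrier[OF S] indexed_product_subset_carrier[of S qs, OF S] by auto
  have "inv s \<in> sym_hull G (S q)"
    using sy(1) S[of q] by (auto simp: sym_hull_def)
  then have "inv s \<in> indexed_product G S [q]"
    using mem_indexed_product_singleton[where S = S and q = q] S by blast
  moreover have "inv x = inv y \<otimes> inv s"
    using car sy(3) by (simp add: inv_mult_group)
  ultimately show ?case
    using mult_mem_indexed_product_append[of S, OF S Cons.IH[OF sy(2)]] by simp
qed simp

lemma conj_mult:
  assumes "g \<in> carrier G" "x \<in> carrier G" "y \<in> carrier G"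
  shows "(g \<otimes> x \<otimes> inv g) \<otimes> (g \<otimes> y \<otimes> inv g) = g \<otimes> (x \<otimes> y) \<otimes> inv g"
proof -
  have "inv g \<otimes> (g \<otimes> (y \<otimes> inv g)) = y \<otimes> inv g"
    using assms by (simp add: m_assoc[symmetric])
  then show ?thesis using assms by (simp add: m_assoc)
qed

text \<open>
  Conjugation is an automorphism, so it passes to the factors, and it commutes with the inversion in
  \<open>sym_hull\<close>.
\<close>

lemma indexed_product_conj:
  assumes S: "\<And>q. S q \<subseteq> carrier G" and g: "g \<in> carrier G"
    and R: "\<And>q s. s \<in> S q \<Longrightarrow> g \<otimes> s \<otimes> inv g \<in> R q"
    and "x \<in> indexed_product G S qs"
  shows "g \<otimes> x \<otimes> inv g \<in> indexed_product G R qs"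
  using assms(4)
proof (induction qs arbitrary: x)
  case Nil
  then show ?case using g by simp
next
  case (Cons q qs)
  then obtain s y where sy: "s \<in> sym_hull G (S q)" "y \<in> indexed_product G S qs" "x = s \<otimes> y"
    by (auto simp: set_mult_def)
  have car: "s \<in> carrier G" "y \<in> carrier G"
    using sy sym_hull_subset_carrier[OF S] indexed_product_subset_carrier[of S qs, OF S] by auto
  have "g \<otimes> s \<otimes> inv g \<in> sym_hull G (R q)"
  proof -
    consider "s \<in> S q" | "s = \<one>" | t where "t \<in> S q" "s = inv t"
      using sy(1) by (auto simp: sym_hull_def)
    then show ?thesis
    proof cases
      case 3
      have "g \<otimes> s \<otimes> inv g = inv (g \<otimes> t \<otimes> inv g)"
        using 3 g S[of q] by (auto simp: inv_mult_group m_assoc subset_eq)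
      then show ?thesis using R[OF 3(1)] by (auto simp: sym_hull_def)
    qed (use R g in \<open>auto simp: sym_hull_def\<close>)
  qed
  moreover have "g \<otimes> x \<otimes> inv g = (g \<otimes> s \<otimes> inv g) \<otimes> (g \<otimes> y \<otimes> inv g)"
    using car g sy(3) by (simp add: conj_mult)
  ultimately show ?case
    using Cons.IH[OF sy(2)] by (auto simp: set_mult_def)
qed

end

text \<open>
  Open rays of rationals have the order type of the rationals. These embeddings relocate an increasing
  sequence of indices beyond, or before, given ones, and so let products be concatenated.
\<close>

lemma strict_mono_embedding_above:
  "\<exists>f :: rat \<Rightarrow> rat. strict_mono f \<and> (\<forall>q. r < f q)"
proof (intro exI conjI allI)
  \<comment> \<open>Up to the shift by \<open>r\<close>, negative numbers go to the interval from 0 to 1, the others to the ray from 1 on.\<close>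
  let ?f = "\<lambda>q::rat. r + (if q \<ge> 0 then q + 1 else 1 / (1 - q))"
  show "strict_mono ?f"
  proof (rule strict_monoI)
    fix x y :: rat assume "x < y"
    moreover have "1 / (1 - x) < 1 / (1 - y)" if "y < 0" "x < y"
      using that by (simp add: divide_simps)
    moreover have "1 / (1 - x) < y + 1" if "x < 0" "0 \<le> y"
    proof -
      have "1 / (1 - x) < 1" using that by (simp add: divide_simps)
      then show ?thesis using that by linarith
    qed
    ultimately show "?f x < ?f y" by (auto simp: not_le)
  qed
  show "r < ?f q" for q by simp
qed

lemma strict_mono_embedding_below:
  "\<exists>f :: rat \<Rightarrow> rat. strict_mono f \<and> (\<forall>q. f q < r)"
proof -
  obtain f :: "rat \<Rightarrow> rat" where f: "strict_mono f" "\<forall>q. - r < f q"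
    using strict_mono_embedding_above by blast
  have "- f (- q) < r" for q
    using f(2)[rule_format, of "- q"] by linarith
  moreover have "strict_mono (\<lambda>q. - f (- q))"
    using f(1) by (simp add: strict_mono_def)
  ultimately show ?thesis by blast
qed

lemma sorted_map_strict_mono:
  fixes f :: "'a::linorder \<Rightarrow> 'b::linorder"
  assumes "strict_mono f" "sorted_wrt (<) qs"
  shows "sorted_wrt (<) (map f qs)"
  using assms(2) strict_monoD[OF assms(1)] unfolding sorted_wrt_map
  by (rule sorted_wrt_mono_rel[rotated])

section \<open>The finest group topology in which a family converges to the neutral element\<close>

locale directed_family = group K for K (structure) +
  fixes F :: "'a set set"
  assumes subset_carrier: "A \<in> F \<Longrightarrow> A \<subseteq> carrier K"
    and nonempty: "F \<noteq> {}"
    and directed: "A \<in> F \<Longrightarrow> B \<in> F \<Longrightarrow> \<exists>C\<in>F. C \<subseteq> A \<inter> B"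
begin

text \<open>
  The candidates \<open>U((S\<^sub>q))\<close> for a neighbourhood basis at the neutral element. The lemmas
  \<open>basic_square\<close>, \<open>basic_inv\<close> and \<open>basic_conj\<close> are the usual axioms for such a basis, and
  \<open>basic_shift\<close> makes its members open.
\<close>

definition basic :: "'a set set" where
  "basic = {rat_products K S | S. \<forall>q. S q \<in> conj_family K F}"

lemma conj_family_subset_carrier:
  assumes "X \<in> conj_family K F"
  shows "X \<subseteq> carrier K"
proof -
  obtain A where A: "A \<in> carrier K \<rightarrow> F" "X = conj_union K A"
    using assms by (auto simp: mem_conj_family_iff)
  have "A g \<subseteq> carrier K" if "g \<in> carrier K" for g
    using subset_carrier[of "A g"] A(1) that by blast
  then show ?thesis unfolding A(2) conj_union_def by auto
qed

lemma conj_family_nonempty: "conj_family K F \<noteq> {}"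
proof -
  obtain A where "A \<in> F" using nonempty by blast
  then have "conj_union K (\<lambda>_. A) \<in> conj_family K F"
    by (auto simp: mem_conj_family_iff)
  then show ?thesis by blast
qed

text \<open>
  The union that defines a member of \<open>F\<^sup>K\<close> runs over all conjugators, so conjugating by \<open>g\<close> merely
  translates the index of the chosen sets. This is why \<open>F\<^sup>K\<close> is used in place of \<open>F\<close>.
\<close>

lemma conj_family_conj:
  assumes "X \<in> conj_family K F" "g \<in> carrier K"
  shows "\<exists>Y\<in>conj_family K F. \<forall>y\<in>Y. g \<otimes> y \<otimes> inv g \<in> X"
proof -
  obtain A where A: "A \<in> carrier K \<rightarrow> F" "X = conj_union K A"
    using assms(1) by (auto simp: mem_conj_family_iff)
  define Y where "Y = conj_union K (\<lambda>k. A (g \<otimes> k))"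
  have "Y \<in> conj_family K F"
    unfolding mem_conj_family_iff Y_def
    using A(1) assms(2) by (intro exI[of _ "\<lambda>k. A (g \<otimes> k)"]) auto
  moreover have "g \<otimes> y \<otimes> inv g \<in> X" if "y \<in> Y" for y
  proof -
    obtain k s where ks: "k \<in> carrier K" "s \<in> A (g \<otimes> k)" "y = k \<otimes> s \<otimes> inv k"
      using \<open>y \<in> Y\<close> by (auto simp: Y_def conj_union_def)
    have "s \<in> carrier K"
      using ks(1,2) A(1) assms(2) subset_carrier[of "A (g \<otimes> k)"] by auto
    then have "g \<otimes> y \<otimes> inv g = (g \<otimes> k) \<otimes> s \<otimes> inv (g \<otimes> k)"
      using ks assms(2) by (simp add: inv_mult_group m_assoc)
    then show ?thesis
      using ks assms(2) unfolding A(2) conj_union_def by blast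
  qed
  ultimately show ?thesis by blast
qed

lemma basicE:
  assumes "U \<in> basic"
  obtains S where "\<And>q. S q \<in> conj_family K F" "\<And>q. S q \<subseteq> carrier K" "U = rat_products K S"
proof -
  obtain S where "U = rat_products K S" "\<forall>q. S q \<in> conj_family K F"
    using assms unfolding basic_def by blast
  then show thesis
    using that[of S] conj_family_subset_carrier by simp
qed

lemma basic_subset_carrier:
  assumes "U \<in> basic"
  shows "U \<subseteq> carrier K"
proof -
  obtain S where S: "\<And>q. S q \<subseteq> carrier K" "U = rat_products K S"
    using assms by (rule basicE) blast
  show ?thesis
    using indexed_product_subset_carrier[of S, OF S(1)] unfolding S(2)
    by (meson mem_rat_products_iff subsetD subsetI)
qed

lemma basic_one:
  assumes "U \<in> basic"
  shows "\<one> \<in> U"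
proof -
  obtain S where U: "U = rat_products K S"
    using assms by (rule basicE)
  show ?thesis
    unfolding U mem_rat_products_iff by (rule exI[of _ "[]"]) simp
qed

lemma basic_nonempty: "basic \<noteq> {}"
proof -
  obtain X where "X \<in> conj_family K F" using conj_family_nonempty by blast
  then have "rat_products K (\<lambda>_. X) \<in> basic"
    unfolding basic_def by blast
  then show ?thesis by blast
qed

text \<open>
  Split the rationals at \<open>0\<close>. If \<open>R q\<close> lies in the sets of \<open>S\<close> at the images of \<open>q\<close> in both
  halves, then of two products over \<open>R\<close> the first can be read with negative and the second with
  positive indices, and their concatenation is a product over \<open>S\<close>.
\<close>

lemma basic_square:
  assumes "U \<in> basic"
  shows "\<exists>V\<in>basic. \<forall>x\<in>V. \<forall>y\<in>V. x \<otimes> y \<in> U"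
proof -
  obtain S where S: "\<And>q. S q \<in> conj_family K F" "\<And>q. S q \<subseteq> carrier K" "U = rat_products K S"
    using assms by (rule basicE) blast
  obtain f :: "rat \<Rightarrow> rat" where f: "strict_mono f" "\<forall>q. f q < 0"
    using strict_mono_embedding_below by blast
  obtain g :: "rat \<Rightarrow> rat" where g: "strict_mono g" "\<forall>q. 0 < g q"
    using strict_mono_embedding_above by blast
  have "\<forall>q. \<exists>Z. Z \<in> conj_family K F \<and> Z \<subseteq> S (f q) \<inter> S (g q)"
    using conj_family_directed[OF directed] S(1) by blast
  then obtain R where R: "\<And>q. R q \<in> conj_family K F" "\<And>q. R q \<subseteq> S (f q) \<inter> S (g q)"
    by metis
  have "x \<otimes> y \<in> U" if x: "x \<in> rat_products K R" and y: "y \<in> rat_products K R" for x y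
  proof -
    have "x \<in> rat_products K (\<lambda>q. S (f q))" "y \<in> rat_products K (\<lambda>q. S (g q))"
      using x y R(2) rat_products_mono[of R "\<lambda>q. S (f q)" K] rat_products_mono[of R "\<lambda>q. S (g q)" K]
      by (meson le_inf_iff subsetD)+
    then obtain ps qs where
      ps: "sorted_wrt (<) ps" "x \<in> indexed_product K S (map f ps)" and
      qs: "sorted_wrt (<) qs" "y \<in> indexed_product K S (map g qs)"
      unfolding mem_rat_products_iff indexed_product_map by blast
    have "sorted_wrt (<) (map f ps @ map g qs)"
      using sorted_map_strict_mono[OF f(1) ps(1)] sorted_map_strict_mono[OF g(1) qs(1)] f(2) g(2)
      by (auto simp: sorted_wrt_append intro: less_trans)
    moreover have "x \<otimes> y \<in> indexed_product K S (map f ps @ map g qs)"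
      using ps(2) qs(2) by (intro mult_mem_indexed_product_append S(2))
    ultimately show ?thesis
      unfolding S(3) mem_rat_products_iff by blast
  qed
  then show ?thesis
    using R(1) unfolding basic_def by blast
qed

text \<open>
  Inversion reverses the indices, and negation is an order-reversing bijection of the rationals that
  puts them back in increasing order.
\<close>

lemma basic_inv:
  assumes "U \<in> basic"
  shows "\<exists>V\<in>basic. \<forall>x\<in>V. inv x \<in> U"
proof -
  obtain S where S: "\<And>q. S q \<in> conj_family K F" "\<And>q. S q \<subseteq> carrier K" "U = rat_products K S"
    using assms by (rule basicE) blast
  have "inv x \<in> U" if x: "x \<in> rat_products K (\<lambda>q. S (- q))" for x
  proof -
    obtain qs where qs: "sorted_wrt (<) qs" "x \<in> indexed_product K S (map uminus qs)"
      using x unfolding mem_rat_products_iff indexed_product_map by blast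
    have "sorted_wrt (<) (rev (map uminus qs))"
      using qs(1) by (simp add: sorted_wrt_rev sorted_wrt_map)
    then show ?thesis
      using indexed_product_rev[of S, OF S(2) qs(2)]
      unfolding S(3) mem_rat_products_iff by blast
  qed
  then show ?thesis
    using S(1) unfolding basic_def by (intro bexI[of _ "rat_products K (\<lambda>q. S (- q))"]) auto
qed

lemma basic_conj:
  assumes "U \<in> basic" and g: "g \<in> carrier K"
  shows "\<exists>V\<in>basic. \<forall>x\<in>V. g \<otimes> x \<otimes> inv g \<in> U"
proof -
  obtain S where S: "\<And>q. S q \<in> conj_family K F" "\<And>q. S q \<subseteq> carrier K" "U = rat_products K S"
    using assms(1) by (rule basicE) blast
  obtain R where R: "\<And>q. R q \<in> conj_family K F" "\<And>q y. y \<in> R q \<Longrightarrow> g \<otimes> y \<otimes> inv g \<in> S q"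
    using conj_family_conj[OF S(1) g] by metis
  have "g \<otimes> x \<otimes> inv g \<in> U" if "x \<in> rat_products K R" for x
    using that indexed_product_conj[of R g S, OF conj_family_subset_carrier[OF R(1)] g R(2)]
    unfolding S(3) mem_rat_products_iff by blast
  then show ?thesis
    using R(1) unfolding basic_def by blast
qed

text \<open>
  An element \<open>u\<close> of \<open>U((S\<^sub>q))\<close> uses only finitely many indices; the sets with larger indices still
  suffice for a whole basic set, which may be multiplied to \<open>u\<close> on the right.
\<close>

lemma basic_shift:
  assumes "U \<in> basic" and u: "u \<in> U"
  shows "\<exists>V\<in>basic. \<forall>x\<in>V. u \<otimes> x \<in> U"
proof -
  obtain S where S: "\<And>q. S q \<in> conj_family K F" "\<And>q. S q \<subseteq> carrier K" "U = rat_products K S"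
    using assms(1) by (rule basicE) blast
  obtain qs where qs: "sorted_wrt (<) qs" "u \<in> indexed_product K S qs"
    using u unfolding S(3) mem_rat_products_iff by blast
  \<comment> \<open>Inserting 0 keeps the maximum meaningful for the empty product.\<close>
  obtain f :: "rat \<Rightarrow> rat" where f: "strict_mono f" "\<forall>q. Max (insert 0 (set qs)) < f q"
    using strict_mono_embedding_above by blast
  have above: "p < f q" if "p \<in> set qs" for p q
    using f(2) that by simp
  have "u \<otimes> x \<in> U" if x: "x \<in> rat_products K (\<lambda>q. S (f q))" for x
  proof -
    obtain ps where ps: "sorted_wrt (<) ps" "x \<in> indexed_product K S (map f ps)"
      using x unfolding mem_rat_products_iff indexed_product_map by blast
    have "sorted_wrt (<) (qs @ map f ps)"
      using sorted_map_strict_mono[OF f(1) ps(1)] qs(1) above by (auto simp: sorted_wrt_append)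
    moreover have "u \<otimes> x \<in> indexed_product K S (qs @ map f ps)"
      using ps(2) qs(2) by (intro mult_mem_indexed_product_append S(2))
    ultimately show ?thesis
      unfolding S(3) mem_rat_products_iff by blast
  qed
  then show ?thesis
    using S(1) unfolding basic_def by (intro bexI[of _ "rat_products K (\<lambda>q. S (f q))"]) auto
qed

text \<open>
  The conjugate by the neutral element of the set chosen for it is one of the pieces of every
  member of \<open>F\<^sup>K\<close>; a single index therefore suffices.
\<close>

lemma basic_contains_member:
  assumes "U \<in> basic"
  shows "\<exists>A\<in>F. A \<subseteq> U"
proof -
  obtain S where S: "\<And>q. S q \<in> conj_family K F" "\<And>q. S q \<subseteq> carrier K" "U = rat_products K S"
    using assms by (rule basicE) blast
  obtain A where A: "A \<in> carrier K \<rightarrow> F" "S 0 = conj_union K A"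
    using S(1)[of 0] by (auto simp: mem_conj_family_iff)
  have A1: "A \<one> \<in> F" using A(1) by blast
  have "x \<in> U" if "x \<in> A \<one>" for x
  proof -
    have xK: "x \<in> carrier K" using that A1 subset_carrier by blast
    have "\<one> \<otimes> x \<otimes> inv \<one> \<in> S 0"
      unfolding A(2) conj_union_def using that by blast
    then have "x \<in> indexed_product K S [0]"
      using xK S(2) by (intro mem_indexed_product_singleton) (auto simp: sym_hull_def)
    then show ?thesis
      unfolding S(3) mem_rat_products_iff by (intro exI[of _ "[0]"]) simp
  qed
  with A1 show ?thesis by blast
qed

abbreviation \<T> :: "'a topology" where
  "\<T> \<equiv> group_topology_of_family K F"

lemma openin_iff:
  "openin \<T> W \<longleftrightarrow> W \<subseteq> carrier K \<and> (\<forall>x\<in>W. \<exists>U\<in>basic. \<forall>u\<in>U. x \<otimes> u \<in> W)"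
proof -
  have "(x <# U \<subseteq> W) \<longleftrightarrow> (\<forall>u\<in>U. x \<otimes> u \<in> W)" for x U
    by (auto simp: l_coset_def)
  moreover have "(\<exists>U\<in>basic. Q U) \<longleftrightarrow> (\<exists>S. (\<forall>q. S q \<in> conj_family K F) \<and> Q (rat_products K S))" for Q
    unfolding basic_def by blast
  ultimately show ?thesis
    by (simp add: openin_group_topology_of_family[OF directed])
qed

lemma topspace_eq: "topspace \<T> = carrier K"
proof
  show "topspace \<T> \<subseteq> carrier K"
    using openin_topspace[of \<T>] unfolding openin_iff by blast
  have "openin \<T> (carrier K)"
    unfolding openin_iff using basic_nonempty basic_subset_carrier by blast
  then show "carrier K \<subseteq> topspace \<T>" by (rule openin_subset)
qed

lemma openin_translate:
  assumes "U \<in> basic" "x \<in> carrier K"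
  shows "openin \<T> ((\<lambda>u. x \<otimes> u) ` U)"
  unfolding openin_iff
proof (intro conjI ballI)
  show "(\<lambda>u. x \<otimes> u) ` U \<subseteq> carrier K"
    using assms basic_subset_carrier by auto
next
  fix y assume "y \<in> (\<lambda>u. x \<otimes> u) ` U"
  then obtain u where u: "u \<in> U" "y = x \<otimes> u" by blast
  obtain V where V: "V \<in> basic" "\<forall>v\<in>V. u \<otimes> v \<in> U"
    using basic_shift[OF assms(1) u(1)] by blast
  have "y \<otimes> v = x \<otimes> (u \<otimes> v)" if "v \<in> V" for v
    using that u V(1) assms basic_subset_carrier by (auto simp: m_assoc subset_eq)
  then show "\<exists>V\<in>basic. \<forall>v\<in>V. y \<otimes> v \<in> (\<lambda>u. x \<otimes> u) ` U"
    using V by auto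
qed

lemma mem_translate:
  assumes "U \<in> basic" "x \<in> carrier K"
  shows "x \<in> (\<lambda>u. x \<otimes> u) ` U"
proof (rule image_eqI)
  show "x = x \<otimes> \<one>" using assms(2) by simp
  show "\<one> \<in> U" using assms(1) by (rule basic_one)
qed

text \<open>
  Continuity of multiplication at \<open>(x, y)\<close> comes from \<open>x a y b = x y (y\<^sup>-\<^sup>1 a y) b\<close>, and continuity of
  inversion at \<open>x\<close> from \<open>(x v)\<^sup>-\<^sup>1 = x\<^sup>-\<^sup>1 (x v\<^sup>-\<^sup>1 x\<^sup>-\<^sup>1)\<close>: the error terms are made small by the closure
  properties of the basis.
\<close>

theorem topological_group_family: "topological_group K \<T>"
  unfolding topological_group_def
proof (intro conjI)
  show "group K" by (rule is_group)
  show "topspace \<T> = carrier K" by (rule topspace_eq)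
  show "continuous_map (prod_topology \<T> \<T>) \<T> (\<lambda>(x, y). x \<otimes> y)"
    unfolding continuous_map_def
  proof (intro conjI allI impI)
    show "(\<lambda>(x, y). x \<otimes> y) \<in> topspace (prod_topology \<T> \<T>) \<rightarrow> topspace \<T>"
      by (auto simp: topspace_eq)
    fix W assume W: "openin \<T> W"
    show "openin (prod_topology \<T> \<T>) {p \<in> topspace (prod_topology \<T> \<T>). (case p of (x, y) \<Rightarrow> x \<otimes> y) \<in> W}"
      unfolding openin_prod_topology_alt
    proof (intro allI impI)
      fix x y
      assume "(x, y) \<in> {p \<in> topspace (prod_topology \<T> \<T>). (case p of (x, y) \<Rightarrow> x \<otimes> y) \<in> W}"
      then have xy: "x \<in> carrier K" "y \<in> carrier K" "x \<otimes> y \<in> W"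
        by (auto simp: topspace_eq)
      obtain U where U: "U \<in> basic" "\<forall>u\<in>U. x \<otimes> y \<otimes> u \<in> W"
        using W xy(3) unfolding openin_iff by blast
      obtain V where V: "V \<in> basic" "\<forall>a\<in>V. \<forall>b\<in>V. a \<otimes> b \<in> U"
        using basic_square[OF U(1)] by blast
      obtain V' where V': "V' \<in> basic" "\<forall>a\<in>V'. inv y \<otimes> a \<otimes> inv (inv y) \<in> V"
        using basic_conj[OF V(1)] xy(2) by blast
      have "(x \<otimes> a) \<otimes> (y \<otimes> b) \<in> W" if "a \<in> V'" "b \<in> V" for a b
      proof -
        have ab: "a \<in> carrier K" "b \<in> carrier K"
          using that V(1) V'(1) basic_subset_carrier by auto
        have "(x \<otimes> a) \<otimes> (y \<otimes> b) = x \<otimes> y \<otimes> ((inv y \<otimes> a \<otimes> inv (inv y)) \<otimes> b)"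
        proof -
          have "y \<otimes> (inv y \<otimes> (a \<otimes> (y \<otimes> b))) = a \<otimes> (y \<otimes> b)"
            using ab xy by (simp add: m_assoc[symmetric])
          then show ?thesis using ab xy by (simp add: m_assoc)
        qed
        with U(2) V(2) V'(2) that show ?thesis by simp
      qed
      then have "(\<lambda>u. x \<otimes> u) ` V' \<times> (\<lambda>u. y \<otimes> u) ` V
          \<subseteq> {p \<in> topspace (prod_topology \<T> \<T>). (case p of (x, y) \<Rightarrow> x \<otimes> y) \<in> W}"
        using xy V(1) V'(1) basic_subset_carrier by (auto simp: topspace_eq subset_eq)
      then show "\<exists>A B. openin \<T> A \<and> openin \<T> B \<and> x \<in> A \<and> y \<in> B \<and>
          A \<times> B \<subseteq> {p \<in> topspace (prod_topology \<T> \<T>). (case p of (x, y) \<Rightarrow> x \<otimes> y) \<in> W}"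
        using V(1) V'(1) xy(1,2) openin_translate mem_translate by meson
    qed
  qed
  show "continuous_map \<T> \<T> (\<lambda>x. inv x)"
    unfolding continuous_map_def
  proof (intro conjI allI impI)
    show "(\<lambda>x. inv x) \<in> topspace \<T> \<rightarrow> topspace \<T>"
      by (auto simp: topspace_eq)
    fix W assume W: "openin \<T> W"
    show "openin \<T> {x \<in> topspace \<T>. inv x \<in> W}"
      unfolding openin_iff
    proof (intro conjI ballI)
      show "{x \<in> topspace \<T>. inv x \<in> W} \<subseteq> carrier K" by (auto simp: topspace_eq)
      fix x assume "x \<in> {x \<in> topspace \<T>. inv x \<in> W}"
      then have x: "x \<in> carrier K" "inv x \<in> W" by (auto simp: topspace_eq)
      obtain U where U: "U \<in> basic" "\<forall>u\<in>U. inv x \<otimes> u \<in> W"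
        using W x(2) unfolding openin_iff by blast
      obtain U' where U': "U' \<in> basic" "\<forall>u\<in>U'. x \<otimes> u \<otimes> inv x \<in> U"
        using basic_conj[OF U(1) x(1)] by blast
      obtain V where V: "V \<in> basic" "\<forall>u\<in>V. inv u \<in> U'"
        using basic_inv[OF U'(1)] by blast
      have "inv (x \<otimes> v) \<in> W" if "v \<in> V" for v
      proof -
        have v: "v \<in> carrier K" using that V(1) basic_subset_carrier by blast
        have "inv (x \<otimes> v) = inv x \<otimes> (x \<otimes> inv v \<otimes> inv x)"
          using x v by (simp add: inv_mult_group m_assoc[symmetric])
        then show ?thesis using U(2) U'(2) V(2) that by simp
      qed
      then show "\<exists>V\<in>basic. \<forall>u\<in>V. x \<otimes> u \<in> {x \<in> topspace \<T>. inv x \<in> W}"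
        using V(1) x(1) basic_subset_carrier by (auto simp: topspace_eq subset_eq)
    qed
  qed
qed

text \<open>
  Convergence passes from \<open>F\<close> to \<open>F\<^sup>K\<close>, since conjugation by each single \<open>g\<close> is continuous and the
  member of \<open>F\<close> may depend on \<open>g\<close>.
\<close>

lemma conj_family_converges:
  assumes \<tau>: "topological_group K \<tau>"
    and conv: "\<And>W. openin \<tau> W \<Longrightarrow> \<one> \<in> W \<Longrightarrow> \<exists>A\<in>F. A \<subseteq> W"
    and W: "openin \<tau> W" "\<one> \<in> W"
  shows "\<exists>X\<in>conj_family K F. X \<subseteq> W"
proof -
  have top: "topspace \<tau> = carrier K" using \<tau> by (simp add: topological_group_def)
  have "\<exists>A\<in>F. \<forall>s\<in>A. g \<otimes> s \<otimes> inv g \<in> W" if g: "g \<in> carrier K" for g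
  proof -
    have "openin \<tau> {s \<in> topspace \<tau>. g \<otimes> s \<otimes> inv g \<in> W}"
      by (intro openin_continuous_map_preimage[OF topological_group_continuous_conj[OF \<tau> g]] W(1))
    moreover have "\<one> \<in> {s \<in> topspace \<tau>. g \<otimes> s \<otimes> inv g \<in> W}"
      using g W(2) by (simp add: top)
    ultimately have "\<exists>B\<in>F. B \<subseteq> {s \<in> topspace \<tau>. g \<otimes> s \<otimes> inv g \<in> W}"
      by (rule conv)
    then show ?thesis by blast
  qed
  then have "\<forall>g\<in>carrier K. \<exists>A. A \<in> F \<and> (\<forall>s\<in>A. g \<otimes> s \<otimes> inv g \<in> W)"
    by blast
  then obtain A where "\<forall>g\<in>carrier K. A g \<in> F \<and> (\<forall>s\<in>A g. g \<otimes> s \<otimes> inv g \<in> W)"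
    by (rule bchoice[THEN exE])
  then have "conj_union K A \<in> conj_family K F" "conj_union K A \<subseteq> W"
    unfolding mem_conj_family_iff by (blast, auto simp: conj_union_def)
  then show ?thesis by blast
qed

text \<open>
  The injection \<open>\<nu>\<close> ranks the indices, and a set of rank \<open>n\<close> lies in \<open>V (Suc n)\<close>. In a product with
  distinct indices let \<open>q\<close> have the smallest rank \<open>n\<close>. All ranks to its left and right are larger, so by
  induction both parts lie in \<open>V (Suc n)\<close>, as does the factor at \<open>q\<close>; the cube condition puts the
  product into \<open>V n\<close>.
\<close>

lemma indexed_product_subset_chain:
  assumes V1: "\<And>n. \<one> \<in> V n"
    and Vinv: "\<And>n x. x \<in> V (Suc n) \<Longrightarrow> inv x \<in> V (Suc n)"
    and Vcube: "\<And>n x y z. x \<in> V (Suc n) \<Longrightarrow> y \<in> V (Suc n) \<Longrightarrow> z \<in> V (Suc n) \<Longrightarrow> x \<otimes> (y \<otimes> z) \<in> V n"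
    and VK: "\<And>n. V n \<subseteq> carrier K"
    and S: "\<And>q. S q \<subseteq> V (Suc (\<nu> q))" and \<nu>: "inj \<nu>"
    and "distinct qs" "\<And>q. q \<in> set qs \<Longrightarrow> m \<le> \<nu> q"
  shows "indexed_product K S qs \<subseteq> V m"
  using assms(7,8)
proof (induction qs arbitrary: m rule: length_induct)
  case (1 qs)
  have dec: "V n \<subseteq> V k" if "k \<le> n" for k n
  proof -
    have "V (Suc n) \<subseteq> V n" for n
    proof
      fix x assume "x \<in> V (Suc n)"
      then show "x \<in> V n" using Vcube[of x n \<one> \<one>] V1[of "Suc n"] VK[of "Suc n"] by auto
    qed
    then show ?thesis using that by (rule lift_Suc_antimono_le)
  qed
  have SK: "S q \<subseteq> carrier K" for q using S VK by blast
  show ?case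
  proof (cases "qs = []")
    case True
    then show ?thesis using V1 by simp
  next
    case False
    then obtain q where q: "q \<in> set qs" "\<And>p. p \<in> set qs \<Longrightarrow> \<nu> q \<le> \<nu> p"
      using ex_min_if_finite[of "\<nu> ` set qs"] by (fastforce simp: not_less)
    obtain ps rs where qs: "qs = ps @ q # rs"
      using q(1) by (auto simp: in_set_conv_decomp)
    have later: "Suc (\<nu> q) \<le> \<nu> p" if "p \<in> set ps \<union> set rs" for p
    proof -
      have "p \<noteq> q" using that 1(2) qs by auto
      then have "\<nu> p \<noteq> \<nu> q" using \<nu> by (auto dest: injD)
      moreover have "\<nu> q \<le> \<nu> p" using q(2) that qs by auto
      ultimately show ?thesis by simp
    qed
    have left: "indexed_product K S ps \<subseteq> V (Suc (\<nu> q))"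
      using 1(1)[rule_format, of ps "Suc (\<nu> q)"] 1(2) later qs by auto
    have right: "indexed_product K S rs \<subseteq> V (Suc (\<nu> q))"
      using 1(1)[rule_format, of rs "Suc (\<nu> q)"] 1(2) later qs by auto
    have mid: "sym_hull K (S q) \<subseteq> V (Suc (\<nu> q))"
      using S[of q] V1 Vinv by (auto simp: sym_hull_def)
    have "indexed_product K S qs \<subseteq> V (\<nu> q)"
      unfolding qs indexed_product_append[of S, OF SK]
      using left mid right Vcube[of _ "\<nu> q"] by (auto simp: set_mult_def subset_eq)
    then show ?thesis using dec[of m "\<nu> q"] 1(3)[OF q(1)] by blast
  qed
qed

text \<open>
  By translation it is enough to find a basic set inside a \<open>\<tau>\<close>-neighbourhood \<open>W\<close> of the neutral element.
  Start with \<open>W\<close>, choose successive neighbourhoods whose cubes lie in their predecessors, and let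
  the set at the rational with number \<open>n\<close> lie in the \<open>Suc n\<close>-th neighbourhood.
\<close>

theorem finer_than_group_topology:
  assumes \<tau>: "topological_group K \<tau>"
    and conv: "\<And>W. openin \<tau> W \<Longrightarrow> \<one> \<in> W \<Longrightarrow> \<exists>A\<in>F. A \<subseteq> W"
  shows "finer_topology \<T> \<tau>"
  unfolding finer_topology_def
proof (intro allI impI)
  have top: "topspace \<tau> = carrier K" using \<tau> by (simp add: topological_group_def)
  have nbhd: "\<exists>U\<in>basic. U \<subseteq> W" if W: "openin \<tau> W" "\<one> \<in> W" for W
  proof -
    \<comment> \<open>\<open>W\<close> itself need not be closed under inversion, whence the exception for index 0.\<close>
    define P where "P = (\<lambda>(n::nat) V. openin \<tau> V \<and> \<one> \<in> V \<and> (if n = 0 then V = W else \<forall>x\<in>V. inv x \<in> V))"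
    have "\<exists>V. \<forall>n. P n (V n) \<and> (\<forall>x\<in>V (Suc n). \<forall>y\<in>V (Suc n). \<forall>z\<in>V (Suc n). x \<otimes> (y \<otimes> z) \<in> V n)"
    proof (rule dependent_nat_choice[where Q = "\<lambda>_ V' V. \<forall>x\<in>V. \<forall>y\<in>V. \<forall>z\<in>V. x \<otimes> (y \<otimes> z) \<in> V'"])
      show "\<exists>V. P 0 V" using W by (simp add: P_def)
      show "\<exists>V. P (Suc n) V \<and> (\<forall>x\<in>V. \<forall>y\<in>V. \<forall>z\<in>V. x \<otimes> (y \<otimes> z) \<in> V')" if "P n V'" for V' n
        using topological_group_cube_neighbourhood[OF \<tau>, of V'] that unfolding P_def by auto
    qed
    then obtain V where V: "\<And>n. P n (V n)"
      "\<And>n x y z. x \<in> V (Suc n) \<Longrightarrow> y \<in> V (Suc n) \<Longrightarrow> z \<in> V (Suc n) \<Longrightarrow> x \<otimes> (y \<otimes> z) \<in> V n"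
      by blast
    have V0: "V 0 = W" and Vinv: "\<And>n x. x \<in> V (Suc n) \<Longrightarrow> inv x \<in> V (Suc n)"
      and V1: "\<And>n. \<one> \<in> V n" and Vopen: "\<And>n. openin \<tau> (V n)"
      using V(1) unfolding P_def by (metis, metis nat.simps(3), metis, metis)
    have VK: "V n \<subseteq> carrier K" for n
      using openin_subset[OF Vopen] top by simp
    have "\<exists>X\<in>conj_family K F. X \<subseteq> V n" for n
      using Vopen V1 by (intro conj_family_converges[OF \<tau> conv])
    then have "\<forall>q::rat. \<exists>X. X \<in> conj_family K F \<and> X \<subseteq> V (Suc (to_nat q))"
      by blast
    then have "\<exists>S. \<forall>q::rat. S q \<in> conj_family K F \<and> S q \<subseteq> V (Suc (to_nat q))"
      by (rule choice)
    then obtain S :: "rat \<Rightarrow> 'a set"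
      where S: "\<And>q. S q \<in> conj_family K F" "\<And>q. S q \<subseteq> V (Suc (to_nat q))"
      by blast
    have "rat_products K S \<subseteq> V 0"
    proof
      fix x assume "x \<in> rat_products K S"
      then obtain qs where qs: "sorted_wrt (<) qs" "x \<in> indexed_product K S qs"
        unfolding mem_rat_products_iff by blast
      have "distinct qs" using qs(1) by (simp add: strict_sorted_iff)
      then have "indexed_product K S qs \<subseteq> V 0"
        by (intro indexed_product_subset_chain[of V S to_nat] V1 Vinv V(2) VK S(2) inj_to_nat) simp_all
      with qs(2) show "x \<in> V 0" by blast
    qed
    with V0 S(1) show ?thesis
      unfolding basic_def by blast
  qed
  fix W assume W: "openin \<tau> W"
  show "openin \<T> W"
    unfolding openin_iff
  proof (intro conjI ballI)
    show WK: "W \<subseteq> carrier K" using openin_subset[OF W] top by simp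
    fix x assume x: "x \<in> W"
    have xK: "x \<in> carrier K" using x WK by blast
    have "openin \<tau> {y \<in> topspace \<tau>. x \<otimes> y \<in> W}"
      by (intro openin_continuous_map_preimage[OF topological_group_continuous_translate[OF \<tau> xK]] W)
    moreover have "\<one> \<in> {y \<in> topspace \<tau>. x \<otimes> y \<in> W}"
      using x xK by (simp add: top)
    ultimately have "\<exists>U\<in>basic. U \<subseteq> {y \<in> topspace \<tau>. x \<otimes> y \<in> W}"
      by (rule nbhd)
    then show "\<exists>U\<in>basic. \<forall>u\<in>U. x \<otimes> u \<in> W"
      by blast
  qed
qed

end


section \<open>Semidirect products of topological groups\<close>

lemma continuous_action_compose:
  assumes "continuous_action \<sigma> \<tau> \<phi>" "continuous_map X \<sigma> f" "continuous_map X \<tau> k"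
  shows "continuous_map X \<tau> (\<lambda>x. \<phi> (f x) (k x))"
  using continuous_map_compose[OF continuous_map_pairedI[OF assms(2,3)], of \<tau> "\<lambda>(g, h). \<phi> g h"]
    assms(1)
  by (simp add: continuous_action_def o_def)

lemma pullback_topological_group:
  assumes L: "group L" and K: "topological_group K T" and f: "f \<in> hom L K"
  shows "topological_group L (pullback_topology (carrier L) f T)"
proof -
  interpret L: group L by (rule L)
  interpret group_hom L K f
    using L K f by (simp add: group_hom_def group_hom_axioms_def topological_group_def)
  let ?P = "pullback_topology (carrier L) f T"
  have topT: "topspace T = carrier K" using K by (simp add: topological_group_def)
  have topP: "topspace ?P = carrier L"
    by (auto simp: topspace_pullback_topology topT)
  have "continuous_map ?P T (id \<circ> f)"
    by (intro continuous_map_pullback continuous_map_id)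
  then have f_cont: "continuous_map ?P T f" by simp
  have "continuous_map (prod_topology ?P ?P) T (\<lambda>p. f (fst p) \<otimes>\<^bsub>K\<^esub> f (snd p))"
    using continuous_map_compose[OF continuous_map_fst f_cont]
      continuous_map_compose[OF continuous_map_snd f_cont]
    by (intro topological_group_continuous_mult[OF K]) (simp_all add: o_def)
  then have "continuous_map (prod_topology ?P ?P) T (f \<circ> (\<lambda>(x, y). x \<otimes>\<^bsub>L\<^esub> y))"
    by (rule continuous_map_eq) (auto simp: topP)
  then have "continuous_map (prod_topology ?P ?P) ?P (\<lambda>(x, y). x \<otimes>\<^bsub>L\<^esub> y)"
    by (rule continuous_map_pullback') (auto simp: topP)
  moreover have "continuous_map ?P ?P (\<lambda>x. inv\<^bsub>L\<^esub> x)"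
  proof (rule continuous_map_pullback')
    show "continuous_map ?P T (f \<circ> (\<lambda>x. inv\<^bsub>L\<^esub> x))"
      using topological_group_continuous_inv[OF K f_cont]
      by (rule continuous_map_eq) (auto simp: topP)
  qed (auto simp: topP)
  ultimately show ?thesis
    using L topP by (simp add: topological_group_def)
qed

text \<open>
  As a pullback from a point, this topology receives every map continuously by the universal
  property of pullbacks.
\<close>

definition indiscrete_topology :: "'a set \<Rightarrow> 'a topology" where
  "indiscrete_topology A = pullback_topology A (\<lambda>_. ()) (discrete_topology UNIV)"

lemma topspace_indiscrete_topology [simp]: "topspace (indiscrete_topology A) = A"
  by (simp add: indiscrete_topology_def topspace_pullback_topology)

lemma continuous_map_indiscrete_topology:
  "f \<in> topspace X \<rightarrow> A \<Longrightarrow> continuous_map X (indiscrete_topology A) f"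
  unfolding indiscrete_topology_def by (rule continuous_map_pullback') (auto simp: o_def)

locale semidirect = H: group H + G: group G
  for H :: "('h, 'n) monoid_scheme" and G :: "('g, 'm) monoid_scheme" +
  fixes \<phi> :: "'g \<Rightarrow> 'h \<Rightarrow> 'h"
  assumes action_hom: "\<phi> \<in> hom G (AutoGroup H)"
begin

lemma action_auto: "g \<in> carrier G \<Longrightarrow> \<phi> g \<in> hom H H \<inter> Bij (carrier H)"
  using hom_in_carrier[OF action_hom] by (simp add: AutoGroup_def auto_def)

lemma action_closed [simp]: "g \<in> carrier G \<Longrightarrow> h \<in> carrier H \<Longrightarrow> \<phi> g h \<in> carrier H"
  using action_auto[of g] by (auto simp: hom_def)

lemma action_mult:
  "g \<in> carrier G \<Longrightarrow> h \<in> carrier H \<Longrightarrow> h' \<in> carrier H \<Longrightarrow>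
    \<phi> g (h \<otimes>\<^bsub>H\<^esub> h') = \<phi> g h \<otimes>\<^bsub>H\<^esub> \<phi> g h'"
  using action_auto[of g] by (auto simp: hom_def)

lemma action_one [simp]: "g \<in> carrier G \<Longrightarrow> \<phi> g \<one>\<^bsub>H\<^esub> = \<one>\<^bsub>H\<^esub>"
  using action_auto[of g] hom_one[of "\<phi> g" H H] by (simp add: H.is_group)

lemma action_compose:
  assumes "g \<in> carrier G" "g' \<in> carrier G" "h \<in> carrier H"
  shows "\<phi> (g \<otimes>\<^bsub>G\<^esub> g') h = \<phi> g (\<phi> g' h)"
proof -
  have "\<phi> (g \<otimes>\<^bsub>G\<^esub> g') = \<phi> g \<otimes>\<^bsub>AutoGroup H\<^esub> \<phi> g'"
    using assms action_hom by (simp add: hom_mult)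
  then show ?thesis
    using assms action_auto by (simp add: AutoGroup_def BijGroup_def compose_def)
qed

lemma action_identity [simp]:
  assumes "h \<in> carrier H"
  shows "\<phi> \<one>\<^bsub>G\<^esub> h = h"
proof -
  have "\<phi> \<one>\<^bsub>G\<^esub> = \<one>\<^bsub>AutoGroup H\<^esub>"
    by (rule hom_one[OF action_hom G.is_group H.AutoGroup])
  then show ?thesis using assms by (simp add: AutoGroup_def BijGroup_def)
qed

abbreviation K :: "('h \<times> 'g) monoid" where
  "K \<equiv> semidirect_product H G \<phi>"

lemma carrier_semidirect [simp]: "carrier K = carrier H \<times> carrier G"
  and one_semidirect [simp]: "\<one>\<^bsub>K\<^esub> = (\<one>\<^bsub>H\<^esub>, \<one>\<^bsub>G\<^esub>)"
  and mult_semidirect [simp]: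
    "(h, g) \<otimes>\<^bsub>K\<^esub> (h', g') = (h \<otimes>\<^bsub>H\<^esub> \<phi> g h', g \<otimes>\<^bsub>G\<^esub> g')"
  by (simp_all add: semidirect_product_def)

lemma left_inverse_semidirect:
  assumes "h \<in> carrier H" "g \<in> carrier G"
  shows "(\<phi> (inv\<^bsub>G\<^esub> g) (inv\<^bsub>H\<^esub> h), inv\<^bsub>G\<^esub> g) \<otimes>\<^bsub>K\<^esub> (h, g) = \<one>\<^bsub>K\<^esub>"
  using assms by (simp add: action_mult[symmetric])

lemma group_semidirect: "group K"
proof (rule groupI)
  fix x assume "x \<in> carrier K"
  then obtain h g where x: "x = (h, g)" "h \<in> carrier H" "g \<in> carrier G" by auto
  then have "(\<phi> (inv\<^bsub>G\<^esub> g) (inv\<^bsub>H\<^esub> h), inv\<^bsub>G\<^esub> g) \<in> carrier K" by simp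
  with x show "\<exists>y\<in>carrier K. y \<otimes>\<^bsub>K\<^esub> x = \<one>\<^bsub>K\<^esub>"
    using left_inverse_semidirect by blast
qed (auto simp: action_mult action_compose H.m_assoc G.m_assoc)

lemma inv_semidirect:
  assumes "h \<in> carrier H" "g \<in> carrier G"
  shows "inv\<^bsub>K\<^esub> (h, g) = (\<phi> (inv\<^bsub>G\<^esub> g) (inv\<^bsub>H\<^esub> h), inv\<^bsub>G\<^esub> g)"
  using assms
  by (intro group.inv_equality[OF group_semidirect left_inverse_semidirect]) auto

text \<open>
  The action of \<open>G\<close> on \<open>H\<close> is conjugation in \<open>K\<close>; this turns continuity of the group operations of
  \<open>K\<close> into continuity of the action.
\<close>

lemma conj_semidirect:
  assumes "h \<in> carrier H" "g \<in> carrier G"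
  shows "(\<one>\<^bsub>H\<^esub>, g) \<otimes>\<^bsub>K\<^esub> (h, \<one>\<^bsub>G\<^esub>) \<otimes>\<^bsub>K\<^esub> inv\<^bsub>K\<^esub> (\<one>\<^bsub>H\<^esub>, g) = (\<phi> g h, \<one>\<^bsub>G\<^esub>)"
  using assms by (simp add: inv_semidirect)

lemma topological_group_semidirect:
  assumes G: "topological_group G \<sigma>" and H: "topological_group H \<rho>"
    and act: "continuous_action \<sigma> \<rho> \<phi>"
  shows "topological_group K (prod_topology \<rho> \<sigma>)"
  unfolding topological_group_def
proof (intro conjI)
  let ?P = "prod_topology \<rho> \<sigma>"
  have top: "topspace \<rho> = carrier H" "topspace \<sigma> = carrier G"
    using G H by (simp_all add: topological_group_def)
  show "group K" by (rule group_semidirect)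
  show "topspace ?P = carrier K" by (simp add: top)
  let ?PP = "prod_topology ?P ?P"
  have c: "continuous_map ?PP \<rho> (\<lambda>p. fst (fst p))" "continuous_map ?PP \<sigma> (\<lambda>p. snd (fst p))"
    "continuous_map ?PP \<rho> (\<lambda>p. fst (snd p))" "continuous_map ?PP \<sigma> (\<lambda>p. snd (snd p))"
    using continuous_map_compose[OF continuous_map_fst continuous_map_fst]
      continuous_map_compose[OF continuous_map_fst continuous_map_snd]
      continuous_map_compose[OF continuous_map_snd continuous_map_fst]
      continuous_map_compose[OF continuous_map_snd continuous_map_snd]
    by (simp_all add: o_def)
  have "continuous_map ?PP ?P
      (\<lambda>p. (fst (fst p) \<otimes>\<^bsub>H\<^esub> \<phi> (snd (fst p)) (fst (snd p)), snd (fst p) \<otimes>\<^bsub>G\<^esub> snd (snd p)))"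
    by (intro continuous_map_pairedI topological_group_continuous_mult[OF H]
        topological_group_continuous_mult[OF G] continuous_action_compose[OF act] c)
  then show "continuous_map ?PP ?P (\<lambda>(x, y). x \<otimes>\<^bsub>K\<^esub> y)"
    by (rule continuous_map_eq) auto
  have "continuous_map ?P ?P (\<lambda>p. (\<phi> (inv\<^bsub>G\<^esub> (snd p)) (inv\<^bsub>H\<^esub> (fst p)), inv\<^bsub>G\<^esub> (snd p)))"
    by (intro continuous_map_pairedI topological_group_continuous_inv[OF H]
        topological_group_continuous_inv[OF G] continuous_action_compose[OF act]
        continuous_map_fst continuous_map_snd)
  then show "continuous_map ?P ?P (\<lambda>x. inv\<^bsub>K\<^esub> x)"
    by (rule continuous_map_eq) (auto simp: top inv_semidirect)
qed

lemma topological_group_indiscrete: "topological_group H (indiscrete_topology (carrier H))"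
  unfolding topological_group_def
  by (auto intro!: continuous_map_indiscrete_topology simp: H.is_group)

lemma continuous_action_indiscrete:
  "topspace \<sigma> = carrier G \<Longrightarrow> continuous_action \<sigma> (indiscrete_topology (carrier H)) \<phi>"
  unfolding continuous_action_def by (auto intro!: continuous_map_indiscrete_topology)

end

section \<open>The topology induced from the discrete topology on the normal factor\<close>

locale topological_semidirect = semidirect H G \<phi>
  for H :: "('h, 'n) monoid_scheme" and G :: "('g, 'm) monoid_scheme"
    and \<phi> :: "'g \<Rightarrow> 'h \<Rightarrow> 'h" +
  fixes \<sigma> :: "'g topology"
  assumes G_topological: "topological_group G \<sigma>"
begin

abbreviation D\<sigma> :: "('h \<times> 'g) topology" where
  "D\<sigma> \<equiv> prod_topology (discrete_topology (carrier H)) \<sigma>"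

abbreviation T :: "('h \<times> 'g) topology" where
  "T \<equiv> star_topology K D\<sigma>"

lemma topspace_\<sigma>: "topspace \<sigma> = carrier G"
  using G_topological by (simp add: topological_group_def)

sublocale nbhds: directed_family K "{V. openin D\<sigma> V \<and> \<one>\<^bsub>K\<^esub> \<in> V}"
proof (intro directed_family.intro directed_family_axioms.intro group_semidirect)
  show "A \<subseteq> carrier K" if "A \<in> {V. openin D\<sigma> V \<and> \<one>\<^bsub>K\<^esub> \<in> V}" for A
    using that openin_subset[of D\<sigma> A] by (simp add: topspace_\<sigma>)
  have "topspace D\<sigma> \<in> {V. openin D\<sigma> V \<and> \<one>\<^bsub>K\<^esub> \<in> V}"
    by (simp add: topspace_\<sigma> del: topspace_prod_topology) (simp add: topspace_\<sigma>)
  then show "{V. openin D\<sigma> V \<and> \<one>\<^bsub>K\<^esub> \<in> V} \<noteq> {}" by blast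
  show "\<exists>C\<in>{V. openin D\<sigma> V \<and> \<one>\<^bsub>K\<^esub> \<in> V}. C \<subseteq> A \<inter> B"
    if "A \<in> {V. openin D\<sigma> V \<and> \<one>\<^bsub>K\<^esub> \<in> V}" "B \<in> {V. openin D\<sigma> V \<and> \<one>\<^bsub>K\<^esub> \<in> V}" for A B
    using that by (intro bexI[of _ "A \<inter> B"]) auto
qed

lemma T_topological: "topological_group K T"
  unfolding star_topology_def by (rule nbhds.topological_group_family)

text \<open>
  The topology \<open>\<rho> \<times> \<sigma>\<close> is a group topology on \<open>K\<close> coarser than \<open>D \<times> \<sigma>\<close>, hence refined by
  \<open>T\<close>. Stated for rectangles, this yields open sets of both \<open>T\<^sub>H\<close> and \<open>T\<^sub>G\<close>.
\<close>

lemma openin_T_Times: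
  assumes \<rho>: "topological_group H \<rho>" "continuous_action \<sigma> \<rho> \<phi>"
    and W: "openin \<rho> W" and V: "openin \<sigma> V"
  shows "openin T (W \<times> V)"
proof -
  have "finer_topology T (prod_topology \<rho> \<sigma>)"
    unfolding star_topology_def
  proof (rule nbhds.finer_than_group_topology)
    show "topological_group K (prod_topology \<rho> \<sigma>)"
      using topological_group_semidirect[OF G_topological \<rho>] .
    fix N assume N: "openin (prod_topology \<rho> \<sigma>) N" "\<one>\<^bsub>K\<^esub> \<in> N"
    have "openin D\<sigma> N"
      unfolding openin_prod_topology_alt
    proof (intro allI impI)
      fix x y assume "(x, y) \<in> N"
      then obtain A B where "openin \<rho> A" "openin \<sigma> B" "x \<in> A" "y \<in> B" "A \<times> B \<subseteq> N"
        using N(1) unfolding openin_prod_topology_alt by meson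
      moreover have "A \<subseteq> carrier H"
        using \<open>openin \<rho> A\<close> openin_subset \<rho>(1) by (auto simp: topological_group_def)
      ultimately show "\<exists>A B. openin (discrete_topology (carrier H)) A \<and> openin \<sigma> B \<and>
          x \<in> A \<and> y \<in> B \<and> A \<times> B \<subseteq> N"
        by (intro exI[of _ A] exI[of _ B]) simp
    qed
    with N(2) show "\<exists>A\<in>{V. openin D\<sigma> V \<and> \<one>\<^bsub>K\<^esub> \<in> V}. A \<subseteq> N" by blast
  qed
  moreover have "openin (prod_topology \<rho> \<sigma>) (W \<times> V)"
    using W V by (simp add: openin_prod_Times_iff)
  ultimately show ?thesis by (simp add: finer_topology_def)
qed

text \<open>
  Around \<open>g\<close>, an open set \<open>U\<close> of \<open>T\<close> contains the translate by \<open>g\<close> of a basic set, which contains a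
  neighbourhood \<open>A\<close> of the neutral element in \<open>D \<times> \<sigma>\<close>. That topology restricts to \<open>\<sigma>\<close> on \<open>G\<close>, so the
  trace of the translate of \<open>A\<close> on \<open>G\<close> is a \<open>\<sigma>\<close>-neighbourhood of \<open>g\<close>.
\<close>

lemma continuous_map_inclusion_G: "continuous_map \<sigma> T (\<lambda>g. (\<one>\<^bsub>H\<^esub>, g))"
  unfolding continuous_map_def
proof (intro conjI allI impI)
  show "(\<lambda>g. (\<one>\<^bsub>H\<^esub>, g)) \<in> topspace \<sigma> \<rightarrow> topspace T"
    using T_topological by (auto simp: topological_group_def topspace_\<sigma>)
  fix U assume U: "openin T U"
  show "openin \<sigma> {g \<in> topspace \<sigma>. (\<one>\<^bsub>H\<^esub>, g) \<in> U}"
  proof (subst openin_subopen, intro ballI)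
    fix g assume "g \<in> {g \<in> topspace \<sigma>. (\<one>\<^bsub>H\<^esub>, g) \<in> U}"
    then have g: "g \<in> carrier G" "(\<one>\<^bsub>H\<^esub>, g) \<in> U" by (auto simp: topspace_\<sigma>)
    have "\<exists>B\<in>nbhds.basic. \<forall>b\<in>B. (\<one>\<^bsub>H\<^esub>, g) \<otimes>\<^bsub>K\<^esub> b \<in> U"
      using U g(2) unfolding star_topology_def nbhds.openin_iff by blast
    then obtain B where B: "B \<in> nbhds.basic" "\<forall>b\<in>B. (\<one>\<^bsub>H\<^esub>, g) \<otimes>\<^bsub>K\<^esub> b \<in> U" by blast
    obtain A where A: "openin D\<sigma> A" "\<one>\<^bsub>K\<^esub> \<in> A" "A \<subseteq> B"
      using nbhds.basic_contains_member[OF B(1)] by blast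
    define N where "N = {x \<in> topspace \<sigma>. (\<one>\<^bsub>H\<^esub>, inv\<^bsub>G\<^esub> g \<otimes>\<^bsub>G\<^esub> x) \<in> A}"
    have "openin \<sigma> N"
      unfolding N_def using g(1)
      by (intro openin_continuous_map_preimage[OF _ A(1)] continuous_map_pairedI
          topological_group_continuous_translate[OF G_topological]) auto
    moreover have "g \<in> N" using g(1) A(2) by (simp add: N_def topspace_\<sigma>)
    moreover have "N \<subseteq> {g \<in> topspace \<sigma>. (\<one>\<^bsub>H\<^esub>, g) \<in> U}"
    proof
      fix x assume "x \<in> N"
      then have x: "x \<in> carrier G" "(\<one>\<^bsub>H\<^esub>, inv\<^bsub>G\<^esub> g \<otimes>\<^bsub>G\<^esub> x) \<in> B"
        using A(3) by (auto simp: N_def topspace_\<sigma>)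
      have "(\<one>\<^bsub>H\<^esub>, g) \<otimes>\<^bsub>K\<^esub> (\<one>\<^bsub>H\<^esub>, inv\<^bsub>G\<^esub> g \<otimes>\<^bsub>G\<^esub> x) = (\<one>\<^bsub>H\<^esub>, x)"
        using g(1) x(1) by (simp add: G.m_assoc[symmetric])
      with B(2) x show "x \<in> {g \<in> topspace \<sigma>. (\<one>\<^bsub>H\<^esub>, g) \<in> U}"
        by (metis (no_types, lifting) mem_Collect_eq topspace_\<sigma>)
    qed
    ultimately show "\<exists>N. openin \<sigma> N \<and> g \<in> N \<and> N \<subseteq> {g \<in> topspace \<sigma>. (\<one>\<^bsub>H\<^esub>, g) \<in> U}" by blast
  qed
qed

abbreviation T\<^sub>G :: "'g topology" where
  "T\<^sub>G \<equiv> pullback_topology (carrier G) (\<lambda>g. (\<one>\<^bsub>H\<^esub>, g)) T"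

abbreviation T\<^sub>H :: "'h topology" where
  "T\<^sub>H \<equiv> pullback_topology (carrier H) (\<lambda>h. (h, \<one>\<^bsub>G\<^esub>)) T"

lemma T\<^sub>G_eq: "T\<^sub>G = \<sigma>"
  unfolding topology_eq
proof (intro allI iffI)
  fix W assume "openin T\<^sub>G W"
  then obtain U where U: "openin T U" "W = (\<lambda>g. (\<one>\<^bsub>H\<^esub>, g)) -` U \<inter> carrier G"
    unfolding openin_pullback_topology by blast
  have "W = {g \<in> topspace \<sigma>. (\<one>\<^bsub>H\<^esub>, g) \<in> U}"
    using U(2) by (auto simp: topspace_\<sigma>)
  then show "openin \<sigma> W"
    using openin_continuous_map_preimage[OF continuous_map_inclusion_G U(1)] by simp
next
  fix W assume W: "openin \<sigma> W"
  \<comment> \<open>The indiscrete topology is admissible on \<open>H\<close>, and \<open>carrier H\<close> is its only nonempty open set.\<close>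
  have "openin (indiscrete_topology (carrier H)) (carrier H)"
    using openin_topspace[of "indiscrete_topology (carrier H)"] by simp
  then have "openin T (carrier H \<times> W)"
    by (intro openin_T_Times[OF topological_group_indiscrete] continuous_action_indiscrete topspace_\<sigma> W)
  moreover have "W = (\<lambda>g. (\<one>\<^bsub>H\<^esub>, g)) -` (carrier H \<times> W) \<inter> carrier G"
    using openin_subset[OF W] by (auto simp: topspace_\<sigma>)
  ultimately show "openin T\<^sub>G W"
    unfolding openin_pullback_topology by blast
qed

lemma T\<^sub>H_topological: "topological_group H T\<^sub>H"
  by (rule pullback_topological_group[OF H.is_group T_topological]) (auto simp: hom_def)

lemma T\<^sub>H_action: "continuous_action \<sigma> T\<^sub>H \<phi>"
  unfolding continuous_action_def
proof (rule continuous_map_pullback')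
  have top: "topspace T\<^sub>H = carrier H"
    using T\<^sub>H_topological by (simp add: topological_group_def)
  have "continuous_map T\<^sub>H T (id \<circ> (\<lambda>h. (h, \<one>\<^bsub>G\<^esub>)))"
    by (intro continuous_map_pullback continuous_map_id)
  then have H: "continuous_map T\<^sub>H T (\<lambda>h. (h, \<one>\<^bsub>G\<^esub>))" by (simp add: o_def)
  let ?P = "prod_topology \<sigma> T\<^sub>H"
  have "continuous_map ?P T (\<lambda>p. (\<one>\<^bsub>H\<^esub>, fst p))" "continuous_map ?P T (\<lambda>p. (snd p, \<one>\<^bsub>G\<^esub>))"
    using continuous_map_compose[OF continuous_map_fst continuous_map_inclusion_G]
      continuous_map_compose[OF continuous_map_snd H]
    by (simp_all add: o_def)
  then have "continuous_map ?P T
      (\<lambda>p. (\<one>\<^bsub>H\<^esub>, fst p) \<otimes>\<^bsub>K\<^esub> (snd p, \<one>\<^bsub>G\<^esub>) \<otimes>\<^bsub>K\<^esub> inv\<^bsub>K\<^esub> (\<one>\<^bsub>H\<^esub>, fst p))"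
    by (intro topological_group_continuous_mult[OF T_topological]
        topological_group_continuous_inv[OF T_topological])
  then show "continuous_map ?P T ((\<lambda>h. (h, \<one>\<^bsub>G\<^esub>)) \<circ> (\<lambda>(g, h). \<phi> g h))"
    by (rule continuous_map_eq)
      (auto simp: top topspace_\<sigma> conj_semidirect simp del: mult_semidirect)
  show "topspace ?P \<subseteq> (\<lambda>(g, h). \<phi> g h) -` carrier H"
    by (auto simp: top topspace_\<sigma>)
qed

lemma T\<^sub>H_finest:
  assumes \<rho>: "topological_group H \<rho>" "continuous_action \<sigma> \<rho> \<phi>"
  shows "finer_topology T\<^sub>H \<rho>"
  unfolding finer_topology_def
proof (intro allI impI)
  fix W assume W: "openin \<rho> W"
  have "openin T (W \<times> carrier G)"
    using openin_topspace[of \<sigma>] by (intro openin_T_Times[OF \<rho> W]) (simp add: topspace_\<sigma>)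
  moreover have "W = (\<lambda>h. (h, \<one>\<^bsub>G\<^esub>)) -` (W \<times> carrier G) \<inter> carrier H"
    using openin_subset[OF W] \<rho>(1) by (auto simp: topological_group_def)
  ultimately show "openin T\<^sub>H W"
    unfolding openin_pullback_topology by blast
qed

end

theorem theorem2p2:
  fixes G :: "('g, 'm) monoid_scheme" and H :: "('h, 'n) monoid_scheme"
    and \<sigma> :: "'g topology" and \<phi> :: "'g \<Rightarrow> 'h \<Rightarrow> 'h"
  assumes "topological_group G \<sigma>" and "group H" and "\<phi> \<in> hom G (AutoGroup H)"
  shows "let T = star_topology (semidirect_product H G \<phi>)
                   (prod_topology (discrete_topology (carrier H)) \<sigma>);
             T\<^sub>H = pullback_topology (carrier H) (\<lambda>h. (h, \<one>\<^bsub>G\<^esub>)) T;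
             T\<^sub>G = pullback_topology (carrier G) (\<lambda>g. (\<one>\<^bsub>H\<^esub>, g)) T
         in T\<^sub>G = \<sigma> \<and>
            (topological_group H T\<^sub>H \<and> continuous_action \<sigma> T\<^sub>H \<phi>) \<and>
            (\<forall>\<rho>. topological_group H \<rho> \<and> continuous_action \<sigma> \<rho> \<phi> \<longrightarrow> finer_topology T\<^sub>H \<rho>)"
proof -
  interpret topological_semidirect H G \<phi> \<sigma>
    using assms
    by (simp add: topological_semidirect_def topological_semidirect_axioms_def semidirect_def
        semidirect_axioms_def topological_group_def)
  show ?thesis
    unfolding Let_def using T\<^sub>G_eq T\<^sub>H_topological T\<^sub>H_action T\<^sub>H_finest by blast
qed

end
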